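(* Let $\{g_k\}_{k\in\mathbb{N}}\subset L^2(\Omega)$ be such that $\|g-g_k\|\le\delta_k\to0$ as $k\to\infty$ (with $\delta_k>0$). Let $J$ be the total variation functional on $L^2(\Omega)$, let $\Gamma$ be Morozov's discrepancy principle with parameter $\rho>1$ and assume that $\lim_{k\to\infty}\Gamma(\delta_k,g_k)=\infty$. If $u^\dagger$ is a $J$-minimizing solution of $Ku=g$ that satisfies the source condition $K^*p^\dagger\in\partial J(u^\dagger)$ with source element $p^\dagger\in L^2(\Omega)$, then, writing $u_k=\mathcal{R}_{\Gamma(\delta_k,g_k)}(g_k)$, the following convergence rate holds: $$d(u_k,u^\dagger)=\|Ku_k-Ku^\dagger\|_{L^2}+|J(u_k)-J(u^\dagger)|=\mathcal{O}(\delta_k).$$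
   Context: $\Omega\subset\mathbb{R}^2$ is open and bounded, $K:L^2(\Omega)\to L^2(\Omega)$ is linear and bounded with adjoint $K^*$ (so $H_1=H_2=L^2(\Omega)$), and $J:L^2(\Omega)\to\mathbb{R}\cup\{\infty\}$ is $J(u)=|\mathrm{D}u|(\Omega)$ (total variation of the distributional derivative) if $u\in\mathrm{BV}(\Omega)$ and $J(u)=+\infty$ otherwise. It is assumed that for every $c\in\mathbb{R}$ every sequence in $\{u:\|Ku\|^2+J(u)\le c\}$ has a weakly convergent subsequence in $L^2(\Omega)$. The element $g$ is attainable: $Ku=g$ for some $u$ with $J(u)<\infty$. A $J$-minimizing solution of $Ku=g$ is a minimizer of $J(u)$ subject to $Ku=g$. The notation $d$ is $d(u,v)=\|Ku-Kv\|_{L^2}+|J(u)-J(v)|$. Augmented Lagrangian method: $\{\tau_n\}_{n\ge1}$ is a fixed sequence of positive numbers, $t_n:=\sum_{k=1}^n\tau_k$, with $t_n\to+\infty$ and $\sup_k\tau_k<\infty$. Given data $g^\delta$ and a fixed starting element $p_0^\delta=p_0\in L^2(\Omega)$, for $n=1,2,\dots$ $$u_n^\delta\in\operatorname{argmin}_{u}\Big(\tfrac{\tau_n}{2}\|Ku-g^\delta\|^2+J(u)-\langle p_{n-1}^\delta,Ku-g^\delta\rangle\Big),\qquad p_n^\delta=p_{n-1}^\delta+\tau_n(g^\delta-Ku_n^\delta).$$ Set $\mathcal{R}_n(g^\delta):=u_n^\delta$. Morozov's discrepancy principle with $\rho>1$ is the stopping rule $\Gamma(\delta,g^\delta):=\min\{n\in\mathbb{N},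 n\ge1:\ \|Ku_n^\delta-g^\delta\|<\rho\delta\}$ (this minimum exists whenever $\|g^\delta-g\|\le\delta$). *)

theory Defs
  imports "HOL-Analysis.Analysis" "HOL-Library.Landau_Symbols"
begin

(* An element of L^2(Omega) is handled through a representative real^2 => real; values outside
   Omega are irrelevant, and equality of classes is equality almost everywhere on Omega. *)

definition L2_space :: "(real^2) set \<Rightarrow> (real^2 \<Rightarrow> real) set" where
  "L2_space \<Omega> = {f \<in> borel_measurable (lebesgue_on \<Omega>). integrable (lebesgue_on \<Omega>) (\<lambda>x. (f x)\<^sup>2)}"

definition L2_eq :: "(real^2) set \<Rightarrow> (real^2 \<Rightarrow> real) \<Rightarrow> (real^2 \<Rightarrow> real) \<Rightarrow> bool" where
  "L2_eq \<Omega> f g \<longleftrightarrow> (AE x in lebesgue_on \<Omega>. f x = g x)"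

definition L2_inner :: "(real^2) set \<Rightarrow> (real^2 \<Rightarrow> real) \<Rightarrow> (real^2 \<Rightarrow> real) \<Rightarrow> real" where
  "L2_inner \<Omega> f g = (LINT x|lebesgue_on \<Omega>. f x * g x)"

definition L2_norm :: "(real^2) set \<Rightarrow> (real^2 \<Rightarrow> real) \<Rightarrow> real" where
  "L2_norm \<Omega> f = sqrt (L2_inner \<Omega> f f)"

definition L2_weakly_converges ::
    "(real^2) set \<Rightarrow> (nat \<Rightarrow> real^2 \<Rightarrow> real) \<Rightarrow> (real^2 \<Rightarrow> real) \<Rightarrow> bool" where
  "L2_weakly_converges \<Omega> u w \<longleftrightarrow>
     (\<forall>v\<in>L2_space \<Omega>. (\<lambda>n. L2_inner \<Omega> (u n) v) \<longlonglongrightarrow> L2_inner \<Omega> w v)"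

(* Linearity (almost everywhere) together with the bound implies that K respects equality
   almost everywhere, so K induces an operator on the classes. *)
definition L2_bounded_linear ::
    "(real^2) set \<Rightarrow> ((real^2 \<Rightarrow> real) \<Rightarrow> (real^2 \<Rightarrow> real)) \<Rightarrow> bool" where
  "L2_bounded_linear \<Omega> K \<longleftrightarrow>
     (\<forall>f\<in>L2_space \<Omega>. K f \<in> L2_space \<Omega>) \<and>
     (\<forall>f\<in>L2_space \<Omega>. \<forall>g\<in>L2_space \<Omega>. L2_eq \<Omega> (K (\<lambda>x. f x + g x)) (\<lambda>x. K f x + K g x)) \<and>
     (\<forall>c. \<forall>f\<in>L2_space \<Omega>. L2_eq \<Omega> (K (\<lambda>x. c * f x)) (\<lambda>x. c * K f x)) \<and>
     (\<exists>C. \<forall>f\<in>L2_space \<Omega>. L2_norm \<Omega> (K f) \<le> C * L2_norm \<Omega> f)"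

definition L2_adjoint ::
    "(real^2) set \<Rightarrow> ((real^2 \<Rightarrow> real) \<Rightarrow> (real^2 \<Rightarrow> real)) \<Rightarrow> ((real^2 \<Rightarrow> real) \<Rightarrow> (real^2 \<Rightarrow> real)) \<Rightarrow> bool"
  where
  "L2_adjoint \<Omega> K K' \<longleftrightarrow>
     (\<forall>v\<in>L2_space \<Omega>. K' v \<in> L2_space \<Omega>) \<and>
     (\<forall>u\<in>L2_space \<Omega>. \<forall>v\<in>L2_space \<Omega>. L2_inner \<Omega> (K u) v = L2_inner \<Omega> u (K' v))"

(* C_c^1(Omega; R^2), each field being extended by zero to the whole plane *)
definition C1c_fields :: "(real^2) set \<Rightarrow> (real^2 \<Rightarrow> real^2) set" where
  "C1c_fields \<Omega> = {\<phi>. (\<forall>x. \<phi> differentiable (at x)) \<and>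
     continuous_on UNIV (\<lambda>x. jacobian \<phi> (at x)) \<and>
     compact (closure {x. \<phi> x \<noteq> 0}) \<and> closure {x. \<phi> x \<noteq> 0} \<subseteq> \<Omega>}"

definition divergence :: "(real^2 \<Rightarrow> real^2) \<Rightarrow> real^2 \<Rightarrow> real" where
  "divergence \<phi> x = trace (jacobian \<phi> (at x))"

definition distributional_gradient ::
    "(real^2) set \<Rightarrow> (real^2 \<Rightarrow> real) \<Rightarrow> (real^2 \<Rightarrow> real^2) \<Rightarrow> real" where
  "distributional_gradient \<Omega> u \<phi> = - (LINT x|lebesgue_on \<Omega>. u x * divergence \<phi> x)"

(* |Du|(Omega), the total variation of Du as a functional on test fields *)
definition total_variation :: "(real^2) set \<Rightarrow> (real^2 \<Rightarrow> real) \<Rightarrow> ereal" where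
  "total_variation \<Omega> u =
     (SUP \<phi>\<in>{\<phi> \<in> C1c_fields \<Omega>. \<forall>x. norm (\<phi> x) \<le> 1}. ereal (distributional_gradient \<Omega> u \<phi>))"

definition BV_space :: "(real^2) set \<Rightarrow> (real^2 \<Rightarrow> real) set" where
  "BV_space \<Omega> = {u. integrable (lebesgue_on \<Omega>) u \<and> total_variation \<Omega> u < \<infinity>}"

definition TV :: "(real^2) set \<Rightarrow> (real^2 \<Rightarrow> real) \<Rightarrow> ereal" where
  "TV \<Omega> u = (if u \<in> BV_space \<Omega> then total_variation \<Omega> u else \<infinity>)"

definition L2_subdifferential ::
    "(real^2) set \<Rightarrow> ((real^2 \<Rightarrow> real) \<Rightarrow> ereal) \<Rightarrow> (real^2 \<Rightarrow> real) \<Rightarrow> (real^2 \<Rightarrow> real) set" where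
  "L2_subdifferential \<Omega> J u =
     {\<xi> \<in> L2_space \<Omega>. J u < \<infinity> \<and> (\<forall>v\<in>L2_space \<Omega>. J u + ereal (L2_inner \<Omega> \<xi> (v - u)) \<le> J v)}"

definition J_minimizing_solution ::
    "(real^2) set \<Rightarrow> ((real^2 \<Rightarrow> real) \<Rightarrow> (real^2 \<Rightarrow> real)) \<Rightarrow> ((real^2 \<Rightarrow> real) \<Rightarrow> ereal) \<Rightarrow>
      (real^2 \<Rightarrow> real) \<Rightarrow> (real^2 \<Rightarrow> real) \<Rightarrow> bool" where
  "J_minimizing_solution \<Omega> K J g u \<longleftrightarrow>
     u \<in> L2_space \<Omega> \<and> L2_eq \<Omega> (K u) g \<and> (\<forall>v\<in>L2_space \<Omega>. L2_eq \<Omega> (K v) g \<longrightarrow> J u \<le> J v)"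

definition sublevel_weakly_compact ::
    "(real^2) set \<Rightarrow> ((real^2 \<Rightarrow> real) \<Rightarrow> (real^2 \<Rightarrow> real)) \<Rightarrow> ((real^2 \<Rightarrow> real) \<Rightarrow> ereal) \<Rightarrow> bool" where
  "sublevel_weakly_compact \<Omega> K J \<longleftrightarrow>
     (\<forall>c::real. \<forall>u :: nat \<Rightarrow> real^2 \<Rightarrow> real.
        (\<forall>n. u n \<in> L2_space \<Omega> \<and> ereal ((L2_norm \<Omega> (K (u n)))\<^sup>2) + J (u n) \<le> ereal c) \<longrightarrow>
        (\<exists>r w. strict_mono r \<and> w \<in> L2_space \<Omega> \<and> L2_weakly_converges \<Omega> (u \<circ> r) w))"

definition alm_objective ::
    "(real^2) set \<Rightarrow> ((real^2 \<Rightarrow> real) \<Rightarrow> (real^2 \<Rightarrow> real)) \<Rightarrow> ((real^2 \<Rightarrow> real) \<Rightarrow> ereal) \<Rightarrow>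
      real \<Rightarrow> (real^2 \<Rightarrow> real) \<Rightarrow> (real^2 \<Rightarrow> real) \<Rightarrow> (real^2 \<Rightarrow> real) \<Rightarrow> ereal" where
  "alm_objective \<Omega> K J t f p u =
     ereal (t / 2 * (L2_norm \<Omega> (K u - f))\<^sup>2) + J u - ereal (L2_inner \<Omega> p (K u - f))"

(* u and p form an admissible run of the augmented Lagrangian method for data f; minimizers need
   not be unique, and u 0 plays no role. *)
definition alm_iterates ::
    "(real^2) set \<Rightarrow> ((real^2 \<Rightarrow> real) \<Rightarrow> (real^2 \<Rightarrow> real)) \<Rightarrow> ((real^2 \<Rightarrow> real) \<Rightarrow> ereal) \<Rightarrow>
      (nat \<Rightarrow> real) \<Rightarrow> (real^2 \<Rightarrow> real) \<Rightarrow> (real^2 \<Rightarrow> real) \<Rightarrow>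
      (nat \<Rightarrow> real^2 \<Rightarrow> real) \<Rightarrow> (nat \<Rightarrow> real^2 \<Rightarrow> real) \<Rightarrow> bool" where
  "alm_iterates \<Omega> K J \<tau> p0 f u p \<longleftrightarrow>
     p 0 = p0 \<and>
     (\<forall>n\<ge>1.
        u n \<in> L2_space \<Omega> \<and>
        (\<forall>v\<in>L2_space \<Omega>. alm_objective \<Omega> K J (\<tau> n) f (p (n - 1)) (u n)
                        \<le> alm_objective \<Omega> K J (\<tau> n) f (p (n - 1)) v) \<and>
        p n \<in> L2_space \<Omega> \<and>
        L2_eq \<Omega> (p n) (\<lambda>x. p (n - 1) x + \<tau> n * (f x - K (u n) x)))"

definition morozov ::
    "(real^2) set \<Rightarrow> ((real^2 \<Rightarrow> real) \<Rightarrow> (real^2 \<Rightarrow> real)) \<Rightarrow> (nat \<Rightarrow> (real^2 \<Rightarrow> real) \<Rightarrow> (real^2 \<Rightarrow> real)) \<Rightarrow>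
      real \<Rightarrow> real \<Rightarrow> (real^2 \<Rightarrow> real) \<Rightarrow> nat" where
  "morozov \<Omega> K R \<rho> \<delta> f = (LEAST n. n \<ge> 1 \<and> L2_norm \<Omega> (K (R n f) - f) < \<rho> * \<delta>)"

definition d_dist ::
    "(real^2) set \<Rightarrow> ((real^2 \<Rightarrow> real) \<Rightarrow> (real^2 \<Rightarrow> real)) \<Rightarrow> ((real^2 \<Rightarrow> real) \<Rightarrow> ereal) \<Rightarrow>
      (real^2 \<Rightarrow> real) \<Rightarrow> (real^2 \<Rightarrow> real) \<Rightarrow> ereal" where
  "d_dist \<Omega> K J u v = ereal (L2_norm \<Omega> (K u - K v)) + \<bar>J u - J v\<bar>"

end

theory Submission
  imports Defs
begin

text \<open>Write \<open>s\<^sub>n = f - K u\<^sub>n\<close>. The optimality condition \<open>K\<^sup>* p\<^sub>n \<in> \<partial>J(u\<^sub>n)\<close> turns the method into a proximal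
  point iteration for the convex dual functional \<open>G(p) = J\<^sup>*(K\<^sup>* p) - \<langle>p, f\<rangle>\<close>, with
  \<open>- s\<^sub>n \<in> \<partial>G(p\<^sub>n)\<close>. Then \<open>2 t\<^sub>n (G(p\<^sub>n) - G(p\<^sup>\<dagger>)) + t\<^sub>n\<^sup>2 \<parallel>s\<^sub>n\<parallel>\<^sup>2 + \<parallel>p\<^sub>n - p\<^sup>\<dagger>\<parallel>\<^sup>2\<close> never exceeds
  \<open>D\<^sup>2 = \<parallel>p\<^sub>0 - p\<^sup>\<dagger>\<parallel>\<^sup>2\<close>, whereas \<open>G(p\<^sub>n) - G(p\<^sup>\<dagger>) \<ge> - \<delta> \<parallel>p\<^sub>n - p\<^sup>\<dagger>\<parallel>\<close>. Completing the square gives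
  \<open>t\<^sub>n\<^sup>2 \<parallel>s\<^sub>n\<parallel>\<^sup>2 \<le> D\<^sup>2 + t\<^sub>n\<^sup>2 \<delta>\<^sup>2\<close> and \<open>\<parallel>p\<^sub>n - p\<^sup>\<dagger>\<parallel> \<le> D + 2 t\<^sub>n \<delta>\<close>. Before the stopping index
  \<open>\<rho> \<delta> \<le> \<parallel>s\<^sub>n\<parallel>\<close>, so \<open>t\<^sub>n \<delta> \<le> D / sqrt (\<rho>\<^sup>2 - 1)\<close>; hence the dual iterates stay bounded up to that
  index, and the subgradient inequalities at \<open>u\<^sub>n\<close> and \<open>u\<^sup>\<dagger>\<close> bound \<open>\<bar>J(u\<^sub>n) - J(u\<^sup>\<dagger>)\<bar>\<close> by a
  constant times \<open>\<parallel>K u\<^sub>n - K u\<^sup>\<dagger>\<parallel> \<le> (\<rho> + 1) \<delta>\<close>.\<close>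

section \<open>The semi-inner product on square-integrable representatives\<close>

lemma L2_space_integrable_mult:
  assumes "f \<in> L2_space \<Omega>" "g \<in> L2_space \<Omega>"
  shows "integrable (lebesgue_on \<Omega>) (\<lambda>x. f x * g x)"
proof (rule Bochner_Integration.integrable_bound)
  show "integrable (lebesgue_on \<Omega>) (\<lambda>x. (f x)\<^sup>2 + (g x)\<^sup>2)"
    using assms by (auto simp: L2_space_def)
  show "(\<lambda>x. f x * g x) \<in> borel_measurable (lebesgue_on \<Omega>)"
    using assms by (auto simp: L2_space_def)
  have "\<bar>a * b\<bar> \<le> a\<^sup>2 + b\<^sup>2" for a b :: real
  proof -
    have "0 \<le> (\<bar>a\<bar> - \<bar>b\<bar>)\<^sup>2" by simp
    then have "2 * \<bar>a * b\<bar> \<le> a\<^sup>2 + b\<^sup>2"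
      by (simp add: power2_diff abs_mult)
    then show ?thesis by linarith
  qed
  then show "AE x in lebesgue_on \<Omega>. norm (f x * g x) \<le> norm ((f x)\<^sup>2 + (g x)\<^sup>2)"
    by auto
qed

lemma L2_space_lincomb:
  assumes "f \<in> L2_space \<Omega>" "g \<in> L2_space \<Omega>"
  shows "(\<lambda>x. a * f x + b * g x) \<in> L2_space \<Omega>"
proof -
  have "(\<lambda>x. (a * f x + b * g x)\<^sup>2) =
      (\<lambda>x. a\<^sup>2 * (f x)\<^sup>2 + b\<^sup>2 * (g x)\<^sup>2 + (2 * a * b) * (f x * g x))"
    by (simp add: power2_eq_square algebra_simps)
  moreover have "integrable (lebesgue_on \<Omega>) \<dots>"
    using assms L2_space_integrable_mult[OF assms] by (auto simp: L2_space_def)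
  moreover have "(\<lambda>x. a * f x + b * g x) \<in> borel_measurable (lebesgue_on \<Omega>)"
    using assms by (auto simp: L2_space_def)
  ultimately show ?thesis
    by (simp add: L2_space_def)
qed

lemma L2_space_scale:
  assumes "f \<in> L2_space \<Omega>"
  shows "(\<lambda>x. a * f x) \<in> L2_space \<Omega>"
  using L2_space_lincomb[OF assms assms, of a 0] by simp

lemma L2_space_diff [simp]:
  assumes "f \<in> L2_space \<Omega>" "g \<in> L2_space \<Omega>"
  shows "f - g \<in> L2_space \<Omega>"
  using L2_space_lincomb[OF assms, of 1 "-1"] by (simp add: fun_diff_def)

lemma L2_inner_commute: "L2_inner \<Omega> f g = L2_inner \<Omega> g f"
  by (simp add: L2_inner_def mult.commute)

lemma L2_inner_lincomb_left:
  assumes "f \<in> L2_space \<Omega>" "g \<in> L2_space \<Omega>" "h \<in> L2_space \<Omega>"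
  shows "L2_inner \<Omega> (\<lambda>x. a * f x + b * g x) h = a * L2_inner \<Omega> f h + b * L2_inner \<Omega> g h"
proof -
  have "(\<lambda>x. (a * f x + b * g x) * h x) = (\<lambda>x. a * (f x * h x) + b * (g x * h x))"
    by (simp add: algebra_simps)
  then show ?thesis
    using L2_space_integrable_mult[OF assms(1,3)] L2_space_integrable_mult[OF assms(2,3)]
    by (simp add: L2_inner_def)
qed

lemma L2_inner_diff_left:
  assumes "f \<in> L2_space \<Omega>" "g \<in> L2_space \<Omega>" "h \<in> L2_space \<Omega>"
  shows "L2_inner \<Omega> (f - g) h = L2_inner \<Omega> f h - L2_inner \<Omega> g h"
  using L2_inner_lincomb_left[OF assms, of 1 "-1"] by (simp add: fun_diff_def)

lemma L2_inner_diff_right: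
  assumes "f \<in> L2_space \<Omega>" "g \<in> L2_space \<Omega>" "h \<in> L2_space \<Omega>"
  shows "L2_inner \<Omega> h (f - g) = L2_inner \<Omega> h f - L2_inner \<Omega> h g"
  using L2_inner_diff_left[OF assms] by (simp add: L2_inner_commute)

text \<open>The integral does not see null sets. This is how identities that hold only almost
  everywhere, such as linearity of \<open>K\<close> and the update of \<open>p\<close>, enter exact
  computations with inner products.\<close>

lemma L2_inner_cong_left:
  assumes "L2_eq \<Omega> f f'" "f \<in> L2_space \<Omega>" "f' \<in> L2_space \<Omega>" "h \<in> L2_space \<Omega>"
  shows "L2_inner \<Omega> f h = L2_inner \<Omega> f' h"
  unfolding L2_inner_def
  by (rule integral_cong_AE) (use assms in \<open>auto simp: L2_space_def L2_eq_def\<close>)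

lemma L2_inner_self_nonneg: "0 \<le> L2_inner \<Omega> f f"
  by (simp add: L2_inner_def)

lemma L2_norm_nonneg [simp]: "0 \<le> L2_norm \<Omega> f"
  by (simp add: L2_norm_def L2_inner_self_nonneg)

lemma L2_norm_square: "(L2_norm \<Omega> f)\<^sup>2 = L2_inner \<Omega> f f"
  by (simp add: L2_norm_def L2_inner_self_nonneg)

lemma L2_norm_minus_commute: "L2_norm \<Omega> (f - g) = L2_norm \<Omega> (g - f)"
  by (simp add: L2_norm_def L2_inner_def algebra_simps)

lemma L2_Cauchy_Schwarz:
  assumes f: "f \<in> L2_space \<Omega>" and g: "g \<in> L2_space \<Omega>"
  shows "\<bar>L2_inner \<Omega> f g\<bar> \<le> L2_norm \<Omega> f * L2_norm \<Omega> g"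
proof -
  let ?A = "L2_inner \<Omega> f f" and ?B = "L2_inner \<Omega> f g" and ?C = "L2_inner \<Omega> g g"
  have quad: "0 \<le> a\<^sup>2 * ?A + 2 * a * b * ?B + b\<^sup>2 * ?C" for a b
  proof -
    let ?h = "\<lambda>x. a * f x + b * g x"
    have h: "?h \<in> L2_space \<Omega>" by (rule L2_space_lincomb[OF f g])
    have "L2_inner \<Omega> ?h ?h = a\<^sup>2 * ?A + 2 * a * b * ?B + b\<^sup>2 * ?C"
      by (simp add: L2_inner_lincomb_left[OF f g h] L2_inner_commute[of \<Omega> _ ?h]
          L2_inner_lincomb_left[OF f g f] L2_inner_lincomb_left[OF f g g]
          L2_inner_commute[of \<Omega> g f] power2_eq_square algebra_simps)
    then show ?thesis
      using L2_inner_self_nonneg[of \<Omega> ?h] by simp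
  qed
  have "?B\<^sup>2 \<le> ?A * ?C"
  proof (cases "?C = 0")
    case True
    \<comment> \<open>Representatives carry only a semi-inner product, so \<open>?C = 0\<close> does
      not give \<open>g = 0\<close>. With \<open>?C = 0\<close> the form is affine in
      \<open>b\<close>, and the chosen \<open>b\<close> would give it the value -1.\<close>
    have "?B = 0"
    proof (rule ccontr)
      assume "?B \<noteq> 0"
      then show False
        using quad[of 1 "- (?A + 1) / (2 * ?B)"] True by (simp add: field_simps)
    qed
    then show ?thesis using True by simp
  next
    case False
    then have C: "?C > 0" using L2_inner_self_nonneg[of \<Omega> g] by linarith
    \<comment> \<open>Up to the factor \<open>?C\<close>, the chosen coefficients give the residual
      of projecting \<open>f\<close> onto \<open>g\<close>.\<close>
    have "0 \<le> ?C * (?A * ?C - ?B\<^sup>2)"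
      using quad[of "?C" "-?B"] by (simp add: power2_eq_square algebra_simps)
    then show ?thesis using C by (simp add: zero_le_mult_iff)
  qed
  then have "sqrt (?B\<^sup>2) \<le> sqrt (?A * ?C)" by (rule real_sqrt_le_mono)
  then show ?thesis by (simp add: L2_norm_def real_sqrt_mult)
qed

lemma L2_norm_triangle_diff:
  assumes f: "f \<in> L2_space \<Omega>" and g: "g \<in> L2_space \<Omega>" and h: "h \<in> L2_space \<Omega>"
  shows "L2_norm \<Omega> (f - h) \<le> L2_norm \<Omega> (f - g) + L2_norm \<Omega> (g - h)"
proof (rule power2_le_imp_le)
  have "(L2_norm \<Omega> (f - h))\<^sup>2 =
      (L2_norm \<Omega> (f - g))\<^sup>2 + 2 * L2_inner \<Omega> (f - g) (g - h) + (L2_norm \<Omega> (g - h))\<^sup>2"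
    using f g h
    by (simp add: L2_norm_square L2_inner_diff_left L2_inner_diff_right L2_inner_commute)
  also have "\<dots> \<le> (L2_norm \<Omega> (f - g) + L2_norm \<Omega> (g - h))\<^sup>2"
    using L2_Cauchy_Schwarz[of "f - g" \<Omega> "g - h"] f g h by (simp add: power2_sum)
  finally show "(L2_norm \<Omega> (f - h))\<^sup>2 \<le> (L2_norm \<Omega> (f - g) + L2_norm \<Omega> (g - h))\<^sup>2" .
qed simp

lemma L2_norm_cong:
  assumes "L2_eq \<Omega> f f'" "f \<in> L2_space \<Omega>" "f' \<in> L2_space \<Omega>"
  shows "L2_norm \<Omega> f = L2_norm \<Omega> f'"
  using L2_inner_cong_left[OF assms assms(2)] L2_inner_cong_left[OF assms assms(3)]
  by (simp add: L2_norm_def L2_inner_commute[of \<Omega> f f'])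

section \<open>Nonnegativity and convexity of total variation\<close>

lemma zero_C1c_field: "(\<lambda>x. 0) \<in> C1c_fields \<Omega>"
  by (simp add: C1c_fields_def jacobian_def frechet_derivative_const matrix_def)

text \<open>The zero field is an admissible test field. This excludes the value
  \<open>- \<infinity>\<close>, so that finite values of \<open>TV\<close> can be treated as
  reals.\<close>

lemma total_variation_nonneg: "0 \<le> total_variation \<Omega> u"
proof -
  have "distributional_gradient \<Omega> u (\<lambda>x. 0) = 0"
    by (simp add: distributional_gradient_def divergence_def jacobian_def
        frechet_derivative_const matrix_def trace_def)
  moreover have "ereal (distributional_gradient \<Omega> u (\<lambda>x. 0)) \<le> total_variation \<Omega> u"
    unfolding total_variation_def by (rule SUP_upper) (simp add: zero_C1c_field)
  ultimately show ?thesis by (simp add: zero_ereal_def)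
qed

lemma TV_nonneg: "0 \<le> TV \<Omega> u"
  by (simp add: TV_def total_variation_nonneg)

lemma continuous_on_divergence:
  assumes "\<phi> \<in> C1c_fields \<Omega>"
  shows "continuous_on UNIV (divergence \<phi>)"
  using assms unfolding C1c_fields_def divergence_def trace_def
  by (auto intro!: continuous_intros)

text \<open>A continuous divergence is bounded on the compact closure of \<open>\<Omega>\<close>.
  Integrability is what makes \<open>distributional_gradient\<close> additive in
  \<open>u\<close>.\<close>

lemma integrable_mult_divergence:
  assumes "open \<Omega>" "bounded \<Omega>" "integrable (lebesgue_on \<Omega>) u" "\<phi> \<in> C1c_fields \<Omega>"
  shows "integrable (lebesgue_on \<Omega>) (\<lambda>x. u x * divergence \<phi> x)"
proof -
  have "compact (divergence \<phi> ` closure \<Omega>)"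
    using continuous_on_divergence[OF assms(4)] assms(2)
    by (intro compact_continuous_image) (auto intro: continuous_on_subset)
  then obtain B where B: "\<And>x. x \<in> closure \<Omega> \<Longrightarrow> \<bar>divergence \<phi> x\<bar> \<le> B"
    by (fastforce dest!: compact_imp_bounded simp: bounded_iff)
  have meas: "divergence \<phi> \<in> borel_measurable (lebesgue_on \<Omega>)"
    using continuous_on_divergence[OF assms(4)] assms(1)
    by (intro continuous_imp_measurable_on_sets_lebesgue) (auto intro: continuous_on_subset)
  show ?thesis
  proof (rule Bochner_Integration.integrable_bound)
    show "integrable (lebesgue_on \<Omega>) (\<lambda>x. B * u x)" using assms(3) by simp
    show "(\<lambda>x. u x * divergence \<phi> x) \<in> borel_measurable (lebesgue_on \<Omega>)"
      using meas assms(3) by (auto simp: integrable_iff_bounded)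
    have "norm (u x * divergence \<phi> x) \<le> norm (B * u x)" if "x \<in> \<Omega>" for x
    proof -
      have "\<bar>divergence \<phi> x\<bar> \<le> \<bar>B\<bar>"
        using B[of x] that closure_subset by fastforce
      then have "\<bar>u x\<bar> * \<bar>divergence \<phi> x\<bar> \<le> \<bar>u x\<bar> * \<bar>B\<bar>"
        by (rule mult_left_mono) simp
      then show ?thesis by (simp add: abs_mult mult.commute)
    qed
    then show "AE x in lebesgue_on \<Omega>. norm (u x * divergence \<phi> x) \<le> norm (B * u x)"
      by (auto intro!: AE_I2)
  qed
qed

text \<open>For each test field the functional is linear in the function, and a supremum of linear
  functionals is convex.\<close>

lemma TV_convex:
  assumes \<Omega>: "open \<Omega>" "bounded \<Omega>" and u: "TV \<Omega> u < \<infinity>" and v: "TV \<Omega> v < \<infinity>"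
    and l: "0 \<le> l" "l \<le> 1"
  shows "TV \<Omega> (\<lambda>x. (1 - l) * u x + l * v x) \<le>
    ereal ((1 - l) * real_of_ereal (TV \<Omega> u) + l * real_of_ereal (TV \<Omega> v))" (is "TV \<Omega> ?w \<le> ?rhs")
proof -
  have BV: "u \<in> BV_space \<Omega>" "v \<in> BV_space \<Omega>"
    using u v by (auto simp: TV_def split: if_splits)
  have int: "integrable (lebesgue_on \<Omega>) u" "integrable (lebesgue_on \<Omega>) v"
    using BV by (auto simp: BV_space_def)
  have le: "total_variation \<Omega> ?w \<le> ?rhs"
    unfolding total_variation_def
  proof (rule SUP_least)
    fix \<phi> assume "\<phi> \<in> {\<phi> \<in> C1c_fields \<Omega>. \<forall>x. norm (\<phi> x) \<le> 1}"
    then have \<phi>: "\<phi> \<in> C1c_fields \<Omega>" "\<forall>x. norm (\<phi> x) \<le> 1" by auto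
    have bound: "distributional_gradient \<Omega> y \<phi> \<le> real_of_ereal (TV \<Omega> y)"
      if "y \<in> BV_space \<Omega>" "TV \<Omega> y < \<infinity>" for y
    proof -
      have "ereal (distributional_gradient \<Omega> y \<phi>) \<le> TV \<Omega> y"
        using that \<phi> unfolding TV_def total_variation_def by (auto intro!: SUP_upper)
      then show ?thesis using that(2) TV_nonneg[of \<Omega> y] by (cases "TV \<Omega> y") auto
    qed
    have "distributional_gradient \<Omega> ?w \<phi> =
        (1 - l) * distributional_gradient \<Omega> u \<phi> + l * distributional_gradient \<Omega> v \<phi>"
    proof -
      have "(\<lambda>x. ?w x * divergence \<phi> x) =
          (\<lambda>x. (1 - l) * (u x * divergence \<phi> x) + l * (v x * divergence \<phi> x))"
        by (simp add: algebra_simps)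
      then show ?thesis
        using integrable_mult_divergence[OF \<Omega> int(1) \<phi>(1)]
          integrable_mult_divergence[OF \<Omega> int(2) \<phi>(1)]
        by (simp add: distributional_gradient_def)
    qed
    also have "\<dots> \<le> (1 - l) * real_of_ereal (TV \<Omega> u) + l * real_of_ereal (TV \<Omega> v)"
      using bound[OF BV(1) u] bound[OF BV(2) v] l by (intro add_mono mult_left_mono) auto
    finally show "ereal (distributional_gradient \<Omega> ?w \<phi>) \<le> ?rhs" by simp
  qed
  \<comment> \<open>Finiteness puts \<open>?w\<close> into \<open>BV_space\<close>, so
    \<open>TV\<close> takes its finite branch there.\<close>
  then have "total_variation \<Omega> ?w < \<infinity>" by (rule le_less_trans) simp
  then have "?w \<in> BV_space \<Omega>"
    using int by (auto simp: BV_space_def)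
  then show ?thesis using le by (simp add: TV_def)
qed

section \<open>Optimality condition of a single minimization step\<close>

lemma alm_objective_finite:
  assumes "TV \<Omega> u < \<infinity>"
  shows "alm_objective \<Omega> K (TV \<Omega>) t f p u =
    ereal (t / 2 * (L2_norm \<Omega> (K u - f))\<^sup>2 + real_of_ereal (TV \<Omega> u) - L2_inner \<Omega> p (K u - f))"
  using assms TV_nonneg[of \<Omega> u] by (cases "TV \<Omega> u") (auto simp: alm_objective_def)

lemma le_if_le_add_small_multiple:
  fixes a b c :: real
  assumes "\<And>l. 0 < l \<Longrightarrow> l \<le> 1 \<Longrightarrow> a \<le> b + l * c"
  shows "a \<le> b"
proof (rule ccontr)
  assume "\<not> a \<le> b"
  \<comment> \<open>This step size makes the error \<open>l * c\<close> at most half of the gap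
    \<open>a - b\<close>; the summand 1 keeps the denominator positive when
    \<open>c = 0\<close>.\<close>
  define l where "l = min 1 ((a - b) / (2 * (\<bar>c\<bar> + 1)))"
  have l: "0 < l" "l \<le> 1" "l \<le> (a - b) / (2 * (\<bar>c\<bar> + 1))"
    using \<open>\<not> a \<le> b\<close> by (auto simp: l_def)
  have "l * c \<le> l * (\<bar>c\<bar> + 1)" using l(1) by (intro mult_left_mono) auto
  also have "\<dots> \<le> (a - b) / 2"
    using l(3) by (simp add: pos_le_divide_eq field_simps)
  finally have "a - b \<le> (a - b) / 2" using assms[OF l(1,2)] by linarith
  then show False using \<open>\<not> a \<le> b\<close> by simp
qed

lemma L2_bounded_linear_lincomb:
  assumes K: "L2_bounded_linear \<Omega> K" and u: "u \<in> L2_space \<Omega>" and v: "v \<in> L2_space \<Omega>"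
  shows "L2_eq \<Omega> (K (\<lambda>x. a * u x + b * v x)) (\<lambda>x. a * K u x + b * K v x)"
proof -
  have "L2_eq \<Omega> (K (\<lambda>x. a * u x + b * v x)) (\<lambda>x. K (\<lambda>x. a * u x) x + K (\<lambda>x. b * v x) x)"
    using K L2_space_scale[OF u, of a] L2_space_scale[OF v, of b]
    by (simp add: L2_bounded_linear_def)
  moreover have "L2_eq \<Omega> (K (\<lambda>x. a * u x)) (\<lambda>x. a * K u x)"
    "L2_eq \<Omega> (K (\<lambda>x. b * v x)) (\<lambda>x. b * K v x)"
    using K u v unfolding L2_bounded_linear_def by blast+
  ultimately show ?thesis
    unfolding L2_eq_def by eventually_elim simp
qed

text \<open>Along the segment from \<open>u\<close> to \<open>v\<close> the fidelity term is an
  exact quadratic in \<open>l\<close> and the linear term is affine; the only inequality is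
  convexity of \<open>TV\<close>.\<close>

lemma alm_objective_convex_combination:
  assumes \<Omega>: "open \<Omega>" "bounded \<Omega>" and K: "L2_bounded_linear \<Omega> K"
    and u: "u \<in> L2_space \<Omega>" "TV \<Omega> u < \<infinity>" and v: "v \<in> L2_space \<Omega>" "TV \<Omega> v < \<infinity>"
    and f: "f \<in> L2_space \<Omega>" and p: "p \<in> L2_space \<Omega>" and l: "0 \<le> l" "l \<le> 1"
  shows "alm_objective \<Omega> K (TV \<Omega>) t f p (\<lambda>x. (1 - l) * u x + l * v x) \<le>
    ereal (t / 2 * ((L2_norm \<Omega> (K u - f))\<^sup>2 + 2 * l * L2_inner \<Omega> (K u - f) (K v - K u)
                     + l\<^sup>2 * (L2_norm \<Omega> (K v - K u))\<^sup>2)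
           + (1 - l) * real_of_ereal (TV \<Omega> u) + l * real_of_ereal (TV \<Omega> v)
           - L2_inner \<Omega> p (K u - f) - l * L2_inner \<Omega> p (K v - K u))"
    (is "alm_objective _ _ _ _ _ _ ?w \<le> _")
proof -
  have Kin: "K h \<in> L2_space \<Omega>" if "h \<in> L2_space \<Omega>" for h
    using K that by (simp add: L2_bounded_linear_def)
  have w: "?w \<in> L2_space \<Omega>" by (rule L2_space_lincomb[OF u(1) v(1)])
  define q where "q = K u - f"
  define d where "d = K v - K u"
  define z where "z = (\<lambda>x. 1 * q x + l * d x)"
  have q: "q \<in> L2_space \<Omega>" and d: "d \<in> L2_space \<Omega>"
    using Kin u v f by (auto simp: q_def d_def)
  then have z: "z \<in> L2_space \<Omega>" unfolding z_def by (rule L2_space_lincomb)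
  \<comment> \<open>\<open>K\<close> is linear only up to null sets, so the residual is replaced by
    the explicit combination \<open>z\<close> before norms and inner products are expanded.\<close>
  have eq: "L2_eq \<Omega> (K ?w - f) z"
    using L2_bounded_linear_lincomb[OF K u(1) v(1), of "1 - l" l]
    unfolding L2_eq_def by eventually_elim (simp add: z_def q_def d_def algebra_simps)
  have norm: "(L2_norm \<Omega> (K ?w - f))\<^sup>2 =
      (L2_norm \<Omega> q)\<^sup>2 + 2 * l * L2_inner \<Omega> q d + l\<^sup>2 * (L2_norm \<Omega> d)\<^sup>2"
  proof -
    have "L2_norm \<Omega> (K ?w - f) = L2_norm \<Omega> z"
      using L2_norm_cong[OF eq] Kin[OF w] f z by simp
    moreover have z_left: "L2_inner \<Omega> z h = L2_inner \<Omega> q h + l * L2_inner \<Omega> d h"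
      if "h \<in> L2_space \<Omega>" for h
      unfolding z_def using L2_inner_lincomb_left[OF q d that, of 1 l] by simp
    have "L2_inner \<Omega> z z = L2_inner \<Omega> z q + l * L2_inner \<Omega> z d"
      using z_left[OF z] by (simp add: L2_inner_commute)
    then have "L2_inner \<Omega> z z = L2_inner \<Omega> q q + 2 * l * L2_inner \<Omega> q d + l\<^sup>2 * L2_inner \<Omega> d d"
      using z_left[OF q] z_left[OF d] L2_inner_commute[of \<Omega> d q]
      by (simp add: power2_eq_square algebra_simps)
    ultimately show ?thesis by (simp add: L2_norm_square)
  qed
  have inner: "L2_inner \<Omega> p (K ?w - f) = L2_inner \<Omega> p q + l * L2_inner \<Omega> p d"
    using L2_inner_cong_left[OF eq _ z p] Kin[OF w] f L2_inner_lincomb_left[OF q d p, of 1 l]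
    by (simp add: z_def L2_inner_commute)
  have TVw: "TV \<Omega> ?w \<le>
      ereal ((1 - l) * real_of_ereal (TV \<Omega> u) + l * real_of_ereal (TV \<Omega> v))"
    by (rule TV_convex[OF \<Omega> u(2) v(2) l])
  then have fin: "TV \<Omega> ?w < \<infinity>" by (rule le_less_trans) simp
  have "real_of_ereal (TV \<Omega> ?w) \<le>
      (1 - l) * real_of_ereal (TV \<Omega> u) + l * real_of_ereal (TV \<Omega> v)"
    using TVw TV_nonneg[of \<Omega> ?w] by (cases "TV \<Omega> ?w") auto
  then show ?thesis
    unfolding alm_objective_finite[OF fin] norm inner ereal_less_eq
    by (simp add: q_def d_def algebra_simps)
qed

text \<open>Optimality condition \<open>K\<^sup>* (p - t (K u - f)) \<in> \<partial>J(u)\<close>, by perturbing \<open>u\<close> in the direction of \<open>v\<close>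
  and letting the step size tend to zero.\<close>
lemma alm_minimizer_subgradient:
  assumes \<Omega>: "open \<Omega>" "bounded \<Omega>" and K: "L2_bounded_linear \<Omega> K"
    and u: "u \<in> L2_space \<Omega>" "TV \<Omega> u < \<infinity>" and v: "v \<in> L2_space \<Omega>" "TV \<Omega> v < \<infinity>"
    and f: "f \<in> L2_space \<Omega>" and p: "p \<in> L2_space \<Omega>"
    and min: "\<And>w. w \<in> L2_space \<Omega> \<Longrightarrow>
      alm_objective \<Omega> K (TV \<Omega>) t f p u \<le> alm_objective \<Omega> K (TV \<Omega>) t f p w"
  shows "real_of_ereal (TV \<Omega> u) + L2_inner \<Omega> p (K v - K u) - t * L2_inner \<Omega> (K u - f) (K v - K u)
    \<le> real_of_ereal (TV \<Omega> v)"
proof (rule le_if_le_add_small_multiple)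
  fix l :: real assume l: "0 < l" "l \<le> 1"
  have "alm_objective \<Omega> K (TV \<Omega>) t f p u
      \<le> alm_objective \<Omega> K (TV \<Omega>) t f p (\<lambda>x. (1 - l) * u x + l * v x)"
    by (intro min L2_space_lincomb u v)
  also note alm_objective_convex_combination[OF \<Omega> K u v f p, of l t]
  \<comment> \<open>The terms of order zero in \<open>l\<close> cancel. Of the rest, only the
    quadratic term keeps a factor \<open>l\<close> after division by \<open>l\<close>, and it
    disappears in the limit.\<close>
  finally have "l * (real_of_ereal (TV \<Omega> u) + L2_inner \<Omega> p (K v - K u)
      - t * L2_inner \<Omega> (K u - f) (K v - K u))
    \<le> l * (real_of_ereal (TV \<Omega> v) + l * (t / 2 * (L2_norm \<Omega> (K v - K u))\<^sup>2))"
    using l by (simp add: alm_objective_finite[OF u(2)] power2_eq_square algebra_simps)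
  then show "real_of_ereal (TV \<Omega> u) + L2_inner \<Omega> p (K v - K u)
      - t * L2_inner \<Omega> (K u - f) (K v - K u)
    \<le> real_of_ereal (TV \<Omega> v) + l * (t / 2 * (L2_norm \<Omega> (K v - K u))\<^sup>2)"
    using l by simp
qed

text \<open>A competitor with finite \<open>TV\<close> has a finite objective, which an infinite
  \<open>TV\<close> at \<open>u\<close> would exceed.\<close>

lemma alm_minimizer_finite:
  assumes "TV \<Omega> v < \<infinity>"
    and "alm_objective \<Omega> K (TV \<Omega>) t f p u \<le> alm_objective \<Omega> K (TV \<Omega>) t f p v"
  shows "TV \<Omega> u < \<infinity>"
proof (rule ccontr)
  assume "\<not> TV \<Omega> u < \<infinity>"
  then have "alm_objective \<Omega> K (TV \<Omega>) t f p u = \<infinity>"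
    by (simp add: alm_objective_def)
  then show False using assms(2) by (simp add: alm_objective_finite[OF assms(1)])
qed

section \<open>Energy decay of the dual iterates\<close>

text \<open>Expanding the nonnegative square of \<open>b - c\<close> suffices. It turns monotonicity
  of the subdifferential into monotonicity of the residuals.\<close>

lemma L2_norm_le_if_inner_self_le:
  assumes b: "b \<in> L2_space \<Omega>" and c: "c \<in> L2_space \<Omega>" and le: "L2_inner \<Omega> b b \<le> L2_inner \<Omega> b c"
  shows "L2_norm \<Omega> b \<le> L2_norm \<Omega> c"
proof -
  have "0 \<le> L2_inner \<Omega> (b - c) (b - c)" by (rule L2_inner_self_nonneg)
  also have "\<dots> = L2_inner \<Omega> b b - 2 * L2_inner \<Omega> b c + L2_inner \<Omega> c c"
    using b c by (simp add: L2_inner_diff_left L2_inner_diff_right L2_inner_commute)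
  finally have "(L2_norm \<Omega> b)\<^sup>2 \<le> (L2_norm \<Omega> c)\<^sup>2"
    using le by (simp add: L2_norm_square)
  then show ?thesis by (rule power2_le_imp_le) simp
qed

text \<open>Here \<open>s n = f - K u_n\<close>, \<open>sd = f - K u_dag\<close>, and \<open>- (\<langle>p n, s n\<rangle> + j n)\<close> is the value of the dual
  functional at \<open>p n\<close>.\<close>
lemma proximal_point_energy:
  fixes \<tau> j :: "nat \<Rightarrow> real"
  assumes s: "\<And>n. n \<ge> 1 \<Longrightarrow> s n \<in> L2_space \<Omega>" and p: "\<And>n. p n \<in> L2_space \<Omega>"
    and sd: "sd \<in> L2_space \<Omega>" and pd: "pd \<in> L2_space \<Omega>"
    and \<tau>: "\<And>n. n \<ge> 1 \<Longrightarrow> \<tau> n > 0"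
    and step: "\<And>n. n \<ge> 1 \<Longrightarrow> L2_eq \<Omega> (p n) (\<lambda>x. p (n - 1) x + \<tau> n * s n x)"
    and sub: "\<And>n m. n \<ge> 1 \<Longrightarrow> m \<ge> 1 \<Longrightarrow> j n + L2_inner \<Omega> (p n) (s n - s m) \<le> j m"
    and source: "\<And>n. n \<ge> 1 \<Longrightarrow> jd + L2_inner \<Omega> pd (sd - s n) \<le> j n"
  shows "n \<ge> 1 \<Longrightarrow> 2 * (\<Sum>k=1..n. \<tau> k) *
      (L2_inner \<Omega> pd sd + jd - L2_inner \<Omega> (p n) (s n) - j n)
      + (\<Sum>k=1..n. \<tau> k)\<^sup>2 * (L2_norm \<Omega> (s n))\<^sup>2 + (L2_norm \<Omega> (p n - pd))\<^sup>2
    \<le> (L2_norm \<Omega> (p 0 - pd))\<^sup>2"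
proof (induction n rule: nat_induct_at_least)
  have upd: "L2_inner \<Omega> (p n) h = L2_inner \<Omega> (p (n - 1)) h + \<tau> n * L2_inner \<Omega> (s n) h"
    if n: "n \<ge> 1" and h: "h \<in> L2_space \<Omega>" for n h
  proof -
    have "(\<lambda>x. 1 * p (n - 1) x + \<tau> n * s n x) \<in> L2_space \<Omega>"
      by (rule L2_space_lincomb[OF p s[OF n]])
    then show ?thesis
      using L2_inner_cong_left[OF step[OF n] p _ h]
        L2_inner_lincomb_left[OF p s[OF n] h, of 1 "n - 1" "\<tau> n"] by simp
  qed
  note diffs = L2_norm_square L2_inner_diff_left L2_inner_diff_right
  \<comment> \<open>Energy inequality of one step: expand the squared distance of \<open>p n\<close>
    to \<open>pd\<close>. Passing from \<open>p (n - 1)\<close> to \<open>p n\<close> in the cross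
    term reverses the sign of the quadratic term, and \<open>source\<close> compares the dual
    values.\<close>
  have prox: "2 * \<tau> n * (L2_inner \<Omega> pd sd + jd - L2_inner \<Omega> (p n) (s n) - j n)
      + (\<tau> n)\<^sup>2 * (L2_norm \<Omega> (s n))\<^sup>2 + (L2_norm \<Omega> (p n - pd))\<^sup>2
      \<le> (L2_norm \<Omega> (p (n - 1) - pd))\<^sup>2" if n: "n \<ge> 1" for n
  proof -
    let ?a = "p (n - 1)"
    have "(L2_norm \<Omega> (p n - pd))\<^sup>2 = (L2_norm \<Omega> (?a - pd))\<^sup>2
        + 2 * \<tau> n * (L2_inner \<Omega> ?a (s n) - L2_inner \<Omega> pd (s n)) + (\<tau> n)\<^sup>2 * L2_inner \<Omega> (s n) (s n)"
    proof -
      have 1: "L2_inner \<Omega> (p n) ?a = L2_inner \<Omega> ?a ?a + \<tau> n * L2_inner \<Omega> ?a (s n)"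
        using upd[OF n p[of "n - 1"]] by (simp add: L2_inner_commute[of \<Omega> "s n"])
      have "L2_inner \<Omega> (p n) (p n) = L2_inner \<Omega> (p n) ?a + \<tau> n * L2_inner \<Omega> (p n) (s n)"
        using upd[OF n p[of n]]
        by (simp only: L2_inner_commute[of \<Omega> ?a "p n"] L2_inner_commute[of \<Omega> "s n" "p n"])
      then have 2: "L2_inner \<Omega> (p n) (p n) = L2_inner \<Omega> ?a ?a + 2 * \<tau> n * L2_inner \<Omega> ?a (s n)
          + (\<tau> n)\<^sup>2 * L2_inner \<Omega> (s n) (s n)"
        using 1 upd[OF n s[OF n]] by (simp add: power2_eq_square algebra_simps)
      have 3: "L2_inner \<Omega> pd (p n) = L2_inner \<Omega> pd ?a + \<tau> n * L2_inner \<Omega> pd (s n)"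
        using upd[OF n pd] by (simp add: L2_inner_commute)
      have "(L2_norm \<Omega> (x - pd))\<^sup>2 = L2_inner \<Omega> x x - 2 * L2_inner \<Omega> pd x + L2_inner \<Omega> pd pd"
        if "x \<in> L2_space \<Omega>" for x
        using that pd by (simp add: diffs L2_inner_commute[of \<Omega> x pd])
      from this[OF p[of n]] this[OF p[of "n - 1"]] 2 3 show ?thesis
        by (simp add: algebra_simps)
    qed
    moreover have "L2_inner \<Omega> (p n) (s n) = L2_inner \<Omega> ?a (s n) + \<tau> n * L2_inner \<Omega> (s n) (s n)"
      by (rule upd[OF n s[OF n]])
    moreover have "\<tau> n * (L2_inner \<Omega> pd sd + jd - j n) \<le> \<tau> n * L2_inner \<Omega> pd (s n)"
      using source[OF n] \<tau>[OF n] sd pd s[OF n]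
      by (intro mult_left_mono) (auto simp: diffs)
    ultimately show ?thesis
      by (simp add: L2_norm_square[of \<Omega> "s n"] power2_eq_square[of "\<tau> n"] algebra_simps)
  qed
  show "2 * (\<Sum>k=1..1. \<tau> k) * (L2_inner \<Omega> pd sd + jd - L2_inner \<Omega> (p 1) (s 1) - j 1)
      + (\<Sum>k=1..1. \<tau> k)\<^sup>2 * (L2_norm \<Omega> (s 1))\<^sup>2 + (L2_norm \<Omega> (p 1 - pd))\<^sup>2
    \<le> (L2_norm \<Omega> (p 0 - pd))\<^sup>2"
    using prox[of 1] by simp
  fix m :: nat
  assume m: "1 \<le> m"
    and IH: "2 * (\<Sum>k=1..m. \<tau> k) * (L2_inner \<Omega> pd sd + jd - L2_inner \<Omega> (p m) (s m) - j m)
      + (\<Sum>k=1..m. \<tau> k)\<^sup>2 * (L2_norm \<Omega> (s m))\<^sup>2 + (L2_norm \<Omega> (p m - pd))\<^sup>2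
    \<le> (L2_norm \<Omega> (p 0 - pd))\<^sup>2"
  define n where "n = Suc m"
  define T where "T = (\<Sum>k=1..m. \<tau> k)"
  define G where "G = (\<lambda>i. - L2_inner \<Omega> (p i) (s i) - j i)"
  define Gd where "Gd = - L2_inner \<Omega> pd sd - jd"
  have n: "n \<ge> 1" "n - 1 = m" by (auto simp: n_def)
  have T: "T \<ge> 0" unfolding T_def by (intro sum_nonneg less_imp_le[OF \<tau>]) auto
  have step_n: "L2_inner \<Omega> (p n) h = L2_inner \<Omega> (p m) h + \<tau> n * L2_inner \<Omega> (s n) h"
    if "h \<in> L2_space \<Omega>" for h
    using upd[OF n(1) that] n(2) by simp
  \<comment> \<open>The subgradient inequality of the old iterate, tested at the new one, makes the
    dual functional decrease.\<close>
  have descent: "G n + \<tau> n * (L2_norm \<Omega> (s n))\<^sup>2 \<le> G m"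
    using sub[OF m n(1)] step_n[OF s[OF n(1)]] p s[OF m] s[OF n(1)]
    by (simp add: G_def diffs)
  \<comment> \<open>Adding the subgradient inequalities for both orders of the indices cancels the
    \<open>j\<close> terms.\<close>
  have res: "(L2_norm \<Omega> (s n))\<^sup>2 \<le> (L2_norm \<Omega> (s m))\<^sup>2"
  proof -
    have "0 \<le> \<tau> n * (L2_inner \<Omega> (s n) (s m) - L2_inner \<Omega> (s n) (s n))"
      using sub[OF m n(1)] sub[OF n(1) m] step_n[OF s[OF n(1)]] step_n[OF s[OF m]]
        p s[OF m] s[OF n(1)] by (simp add: diffs algebra_simps)
    then have "L2_inner \<Omega> (s n) (s n) \<le> L2_inner \<Omega> (s n) (s m)"
      using \<tau>[OF n(1)] by (simp add: zero_le_mult_iff)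
    from L2_norm_le_if_inner_self_le[OF s[OF n(1)] s[OF m] this]
    show ?thesis by (simp add: power_mono)
  qed
  \<comment> \<open>The three groups match the three estimates: the first is \<open>prox\<close>,
    the second \<open>descent\<close> with weight \<open>2 * T\<close>, the third \<open>res\<close>
    with weight \<open>T^2\<close>. The cross term of \<open>(T + \<tau> n)^2\<close> is exactly
    what \<open>descent\<close> pays for.\<close>
  have "2 * (T + \<tau> n) * (G n - Gd) + (T + \<tau> n)\<^sup>2 * (L2_norm \<Omega> (s n))\<^sup>2 + (L2_norm \<Omega> (p n - pd))\<^sup>2
      = (2 * \<tau> n * (G n - Gd) + (\<tau> n)\<^sup>2 * (L2_norm \<Omega> (s n))\<^sup>2 + (L2_norm \<Omega> (p n - pd))\<^sup>2)
        + 2 * T * (G n + \<tau> n * (L2_norm \<Omega> (s n))\<^sup>2 - Gd) + T\<^sup>2 * (L2_norm \<Omega> (s n))\<^sup>2"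
    by (simp add: power2_eq_square algebra_simps)
  also have "\<dots> \<le> (L2_norm \<Omega> (p m - pd))\<^sup>2 + 2 * T * (G m - Gd) + T\<^sup>2 * (L2_norm \<Omega> (s m))\<^sup>2"
    using prox[OF n(1)] n(2) descent res T
    by (intro add_mono mult_left_mono) (auto simp: G_def Gd_def algebra_simps)
  also have "\<dots> \<le> (L2_norm \<Omega> (p 0 - pd))\<^sup>2"
    using IH by (simp add: G_def Gd_def T_def algebra_simps)
  finally show "2 * (\<Sum>k=1..Suc m. \<tau> k) *
      (L2_inner \<Omega> pd sd + jd - L2_inner \<Omega> (p (Suc m)) (s (Suc m)) - j (Suc m))
      + (\<Sum>k=1..Suc m. \<tau> k)\<^sup>2 * (L2_norm \<Omega> (s (Suc m)))\<^sup>2 + (L2_norm \<Omega> (p (Suc m) - pd))\<^sup>2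
    \<le> (L2_norm \<Omega> (p 0 - pd))\<^sup>2"
    by (simp add: G_def Gd_def T_def n_def algebra_simps)
qed

section \<open>Residual and dual bounds for noisy data\<close>

lemma alm_iterates_bounds:
  fixes \<tau> :: "nat \<Rightarrow> real" and u p :: "nat \<Rightarrow> real^2 \<Rightarrow> real"
  defines "T \<equiv> \<lambda>n. \<Sum>k=1..n. \<tau> k"
  assumes \<Omega>: "open \<Omega>" "bounded \<Omega>" and K: "L2_bounded_linear \<Omega> K"
    and adj: "L2_adjoint \<Omega> K Kadj"
    and \<tau>: "\<And>n. n \<ge> 1 \<Longrightarrow> \<tau> n > 0" and p0: "p0 \<in> L2_space \<Omega>"
    and f: "f \<in> L2_space \<Omega>" and run: "alm_iterates \<Omega> K (TV \<Omega>) \<tau> p0 f u p"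
    and ud: "ud \<in> L2_space \<Omega>" and pd: "pd \<in> L2_space \<Omega>"
    and source: "Kadj pd \<in> L2_subdifferential \<Omega> (TV \<Omega>) ud"
    and noise: "L2_norm \<Omega> (K ud - f) \<le> d"
    and n: "n \<ge> 1"
  shows "TV \<Omega> (u n) < \<infinity>"
    and "(T n)\<^sup>2 * (L2_norm \<Omega> (K (u n) - f))\<^sup>2 \<le> (L2_norm \<Omega> (p0 - pd))\<^sup>2 + (T n * d)\<^sup>2"
    and "\<bar>real_of_ereal (TV \<Omega> (u n)) - real_of_ereal (TV \<Omega> ud)\<bar> \<le>
      (L2_norm \<Omega> pd + L2_norm \<Omega> (p0 - pd) + 2 * T n * d) * L2_norm \<Omega> (K (u n) - K ud)"
proof -
  define J where "J = (\<lambda>v. real_of_ereal (TV \<Omega> v))"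
  define s where "s = (\<lambda>n. f - K (u n))"
  define sd where "sd = f - K ud"
  have Kin: "K h \<in> L2_space \<Omega>" if "h \<in> L2_space \<Omega>" for h
    using K that by (simp add: L2_bounded_linear_def)
  have fin_ud: "TV \<Omega> ud < \<infinity>" using source by (simp add: L2_subdifferential_def)
  have u: "u n \<in> L2_space \<Omega>" if "n \<ge> 1" for n
    using run that by (simp add: alm_iterates_def)
  have p_0: "p 0 = p0" using run by (simp add: alm_iterates_def)
  have p: "p n \<in> L2_space \<Omega>" for n
    using run p0 by (cases "n = 0") (auto simp: alm_iterates_def)
  have min: "alm_objective \<Omega> K (TV \<Omega>) (\<tau> n) f (p (n - 1)) (u n)
      \<le> alm_objective \<Omega> K (TV \<Omega>) (\<tau> n) f (p (n - 1)) v" if "n \<ge> 1" "v \<in> L2_space \<Omega>" for n v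
    using run that by (simp add: alm_iterates_def)
  have step: "L2_eq \<Omega> (p n) (\<lambda>x. p (n - 1) x + \<tau> n * s n x)" if "n \<ge> 1" for n
    using run that by (simp add: alm_iterates_def s_def)
  have s: "s n \<in> L2_space \<Omega>" if "n \<ge> 1" for n
    using u[OF that] f Kin by (simp add: s_def)
  have sd: "sd \<in> L2_space \<Omega>" using f Kin ud by (simp add: sd_def)
  have fin: "TV \<Omega> (u n) < \<infinity>" if "n \<ge> 1" for n
    by (rule alm_minimizer_finite[OF fin_ud min[OF that ud]])
  then show "TV \<Omega> (u n) < \<infinity>" using n by simp
  \<comment> \<open>The dual update is designed so that \<open>p n\<close> is
    \<open>p (n - 1)\<close> minus \<open>\<tau> n\<close> times \<open>K (u n) - f\<close>, which
    is the element in the optimality condition.\<close>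
  have subgrad: "J (u n) + L2_inner \<Omega> (p n) (K v - K (u n)) \<le> J v"
    if n: "n \<ge> 1" and v: "v \<in> L2_space \<Omega>" "TV \<Omega> v < \<infinity>" for n v
  proof -
    have d: "K v - K (u n) \<in> L2_space \<Omega>" using Kin v u[OF n] by simp
    have q: "(\<lambda>x. 1 * p (n - 1) x + \<tau> n * s n x) \<in> L2_space \<Omega>"
      by (rule L2_space_lincomb[OF p s[OF n]])
    have "L2_inner \<Omega> (p n) (K v - K (u n)) =
        L2_inner \<Omega> (p (n - 1)) (K v - K (u n)) + \<tau> n * L2_inner \<Omega> (s n) (K v - K (u n))"
      using L2_inner_cong_left[OF step[OF n] p _ d] q
        L2_inner_lincomb_left[OF p s[OF n] d, of 1 "n - 1" "\<tau> n"] by simp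
    also have "L2_inner \<Omega> (s n) (K v - K (u n)) = - L2_inner \<Omega> (K (u n) - f) (K v - K (u n))"
      using f Kin u[OF n] d by (simp add: s_def L2_inner_diff_left)
    finally show ?thesis
      using alm_minimizer_subgradient[OF \<Omega> K u[OF n] fin[OF n] v f p min[OF n]]
      by (simp add: J_def fun_diff_def)
  qed
  have source': "J ud + L2_inner \<Omega> pd (K v - K ud) \<le> J v"
    if v: "v \<in> L2_space \<Omega>" "TV \<Omega> v < \<infinity>" for v
  proof -
    have "TV \<Omega> ud + ereal (L2_inner \<Omega> (Kadj pd) (v - ud)) \<le> TV \<Omega> v"
      using source v by (simp add: L2_subdifferential_def)
    moreover have "L2_inner \<Omega> (Kadj pd) (v - ud) = L2_inner \<Omega> pd (K v - K ud)"
    proof -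
      have "Kadj pd \<in> L2_space \<Omega>"
        and "\<And>w. w \<in> L2_space \<Omega> \<Longrightarrow> L2_inner \<Omega> (Kadj pd) w = L2_inner \<Omega> pd (K w)"
        using adj pd by (simp_all add: L2_adjoint_def L2_inner_commute)
      then show ?thesis using v ud pd Kin by (simp add: L2_inner_diff_right)
    qed
    ultimately show ?thesis
      using fin_ud v(2) TV_nonneg[of \<Omega> ud] TV_nonneg[of \<Omega> v]
      by (cases "TV \<Omega> ud"; cases "TV \<Omega> v") (auto simp: J_def)
  qed
  have diff: "s n - s m = K (u m) - K (u n)" "s n - sd = K ud - K (u n)"
    "sd - s n = K (u n) - K ud" for n m
    by (auto simp: s_def sd_def)
  define e where "e = L2_norm \<Omega> (p n - pd)"
  define D where "D = L2_norm \<Omega> (p0 - pd)"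
  define G where "G = L2_inner \<Omega> pd sd + J ud - L2_inner \<Omega> (p n) (s n) - J (u n)"
  have T: "T n \<ge> 0" unfolding T_def by (intro sum_nonneg less_imp_le[OF \<tau>]) auto
  have "2 * T n * G + (T n)\<^sup>2 * (L2_norm \<Omega> (s n))\<^sup>2 + e\<^sup>2 \<le> D\<^sup>2"
    unfolding T_def G_def e_def D_def p_0[symmetric]
  proof (rule proximal_point_energy[where j = "\<lambda>n. J (u n)" and s = s and p = p and \<tau> = \<tau>])
    show "J (u n) + L2_inner \<Omega> (p n) (s n - s m) \<le> J (u m)" if "n \<ge> 1" "m \<ge> 1" for n m
      using subgrad[OF that(1) u fin] that(2) by (simp add: diff)
    show "J ud + L2_inner \<Omega> pd (sd - s n) \<le> J (u n)" if "n \<ge> 1" for n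
      using source'[OF u fin] that by (simp add: diff)
  qed (use s p sd pd \<tau> step n in auto)
  \<comment> \<open>For noisy data \<open>pd\<close> need not minimize the dual functional, so
    \<open>G\<close> may be negative. Testing the subgradient at \<open>u n\<close> with
    \<open>ud\<close> bounds \<open>G\<close> below by the pairing of \<open>p n - pd\<close> with
    the noise \<open>sd\<close>, up to sign.\<close>
  moreover have "2 * T n * (- (d * e)) \<le> 2 * T n * G"
  proof -
    have "\<bar>L2_inner \<Omega> sd (p n - pd)\<bar> \<le> L2_norm \<Omega> sd * e"
      unfolding e_def by (rule L2_Cauchy_Schwarz) (use sd p pd in auto)
    also have "\<dots> \<le> d * e"
      using noise by (intro mult_right_mono) (auto simp: e_def sd_def L2_norm_minus_commute)
    finally have "- (d * e) \<le> - L2_inner \<Omega> sd (p n - pd)" by linarith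
    also have "\<dots> \<le> G"
      using subgrad[OF n ud fin_ud] sd s[OF n] p pd
      by (simp add: G_def diff(2)[symmetric] L2_inner_diff_left L2_inner_diff_right
          L2_inner_commute[of \<Omega> sd])
    finally show ?thesis using T by (intro mult_left_mono) auto
  qed
  ultimately have energy: "(T n)\<^sup>2 * (L2_norm \<Omega> (s n))\<^sup>2 + (e - T n * d)\<^sup>2 \<le> D\<^sup>2 + (T n * d)\<^sup>2"
    by (simp add: power2_diff algebra_simps)
  have flip: "L2_norm \<Omega> (s n) = L2_norm \<Omega> (K (u n) - f)"
    unfolding s_def by (rule L2_norm_minus_commute)
  show "(T n)\<^sup>2 * (L2_norm \<Omega> (K (u n) - f))\<^sup>2 \<le> (L2_norm \<Omega> (p0 - pd))\<^sup>2 + (T n * d)\<^sup>2"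
    using energy[unfolded flip D_def] zero_le_power2[of "e - T n * d"] by linarith
  have d: "d \<ge> 0" using noise L2_norm_nonneg order_trans by blast
  have D: "D \<ge> 0" by (simp add: D_def)
  \<comment> \<open>Dropping the residual term of \<open>energy\<close>, instead of the completed
    square, bounds the dual distance \<open>e\<close>.\<close>
  have "0 \<le> (T n)\<^sup>2 * (L2_norm \<Omega> (s n))\<^sup>2" by simp
  then have "(e - T n * d)\<^sup>2 \<le> D\<^sup>2 + (T n * d)\<^sup>2" using energy by linarith
  also have "\<dots> \<le> (D + T n * d)\<^sup>2"
    using D d T by (simp add: power2_sum)
  finally have "e - T n * d \<le> D + T n * d"
    by (rule power2_le_imp_le) (use D d T in simp)
  then have e: "e \<le> D + 2 * T n * d" by (simp add: algebra_simps)
  let ?r = "L2_norm \<Omega> (K (u n) - K ud)"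
  have r: "?r \<ge> 0" by simp
  have rin: "K (u n) - K ud \<in> L2_space \<Omega>" using Kin u[OF n] ud by simp
  have pd_r: "\<bar>L2_inner \<Omega> pd (K (u n) - K ud)\<bar> \<le> L2_norm \<Omega> pd * ?r"
    by (rule L2_Cauchy_Schwarz[OF pd rin])
  have "\<bar>L2_inner \<Omega> (p n - pd) (K (u n) - K ud)\<bar> \<le> e * ?r"
    unfolding e_def by (rule L2_Cauchy_Schwarz[OF _ rin]) (use p pd in auto)
  also have "\<dots> \<le> (D + 2 * T n * d) * ?r" by (rule mult_right_mono[OF e r])
  finally have e_r: "\<bar>L2_inner \<Omega> (p n - pd) (K (u n) - K ud)\<bar> \<le> (D + 2 * T n * d) * ?r" .
  \<comment> \<open>The source condition bounds \<open>J (u n) - J ud\<close> below using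
    \<open>pd\<close> alone. This sign relaxes that bound to the constant of the upper one, where
    \<open>p n\<close> is split into \<open>pd\<close> and \<open>p n - pd\<close>.\<close>
  have "0 \<le> (D + 2 * T n * d) * ?r" using D T d by simp
  moreover have "J (u n) \<le> J ud + L2_inner \<Omega> (p n) (K (u n) - K ud)"
    using subgrad[OF n ud fin_ud] p Kin u[OF n] ud by (simp add: L2_inner_diff_right)
  moreover have "L2_inner \<Omega> (p n) (K (u n) - K ud) =
      L2_inner \<Omega> pd (K (u n) - K ud) + L2_inner \<Omega> (p n - pd) (K (u n) - K ud)"
    using p pd rin by (simp add: L2_inner_diff_left)
  moreover note source'[OF u[OF n] fin[OF n]] pd_r e_r
  ultimately have "\<bar>J (u n) - J ud\<bar> \<le> L2_norm \<Omega> pd * ?r + (D + 2 * T n * d) * ?r"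
    by linarith
  then show "\<bar>real_of_ereal (TV \<Omega> (u n)) - real_of_ereal (TV \<Omega> ud)\<bar> \<le>
      (L2_norm \<Omega> pd + L2_norm \<Omega> (p0 - pd) + 2 * T n * d) * L2_norm \<Omega> (K (u n) - K ud)"
    by (simp add: J_def D_def algebra_simps)
qed

section \<open>The stopping index and the convergence rate\<close>

text \<open>\<open>LEAST\<close> has its defining properties only if some index passes the test,
  hence the existence hypothesis.\<close>

lemma morozov_stopping:
  assumes "\<exists>n\<ge>1. L2_norm \<Omega> (K (R n f) - f) < \<rho> * d"
  shows "morozov \<Omega> K R \<rho> d f \<ge> 1"
    and "L2_norm \<Omega> (K (R (morozov \<Omega> K R \<rho> d f) f) - f) < \<rho> * d"
    and "\<And>n. 1 \<le> n \<Longrightarrow> n < morozov \<Omega> K R \<rho> d f \<Longrightarrow> \<rho> * d \<le> L2_norm \<Omega> (K (R n f) - f)"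
proof -
  let ?P = "\<lambda>n. n \<ge> 1 \<and> L2_norm \<Omega> (K (R n f) - f) < \<rho> * d"
  have "?P (morozov \<Omega> K R \<rho> d f)"
    using assms unfolding morozov_def by (elim exE) (rule LeastI)
  then show "morozov \<Omega> K R \<rho> d f \<ge> 1"
    "L2_norm \<Omega> (K (R (morozov \<Omega> K R \<rho> d f) f) - f) < \<rho> * d" by auto
  show "\<rho> * d \<le> L2_norm \<Omega> (K (R n f) - f)" if "1 \<le> n" "n < morozov \<Omega> K R \<rho> d f" for n
    using not_less_Least[of n ?P] that unfolding morozov_def by auto
qed

theorem proposition5p3:
  fixes \<Omega> :: "(real^2) set"
    and K Kadj :: "(real^2 \<Rightarrow> real) \<Rightarrow> (real^2 \<Rightarrow> real)"
    and g p0 u_dag p_dag :: "real^2 \<Rightarrow> real"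
    and g_seq :: "nat \<Rightarrow> real^2 \<Rightarrow> real"
    and \<tau> \<delta> :: "nat \<Rightarrow> real"
    and \<rho> :: real
    and R P :: "nat \<Rightarrow> (real^2 \<Rightarrow> real) \<Rightarrow> (real^2 \<Rightarrow> real)"
  defines "\<Gamma> \<equiv> morozov \<Omega> K R \<rho>"
  assumes "open \<Omega>" and "bounded \<Omega>"
    and "L2_bounded_linear \<Omega> K" and "L2_adjoint \<Omega> K Kadj"
    and "sublevel_weakly_compact \<Omega> K (TV \<Omega>)"
    and "g \<in> L2_space \<Omega>"
    and attainable: "\<exists>u\<in>L2_space \<Omega>. L2_eq \<Omega> (K u) g \<and> TV \<Omega> u < \<infinity>"
    and "\<And>n. n \<ge> 1 \<Longrightarrow> \<tau> n > 0"
    and "filterlim (\<lambda>n. \<Sum>k=1..n. \<tau> k) at_top sequentially"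
    and "bdd_above (\<tau> ` {1..})"
    and "p0 \<in> L2_space \<Omega>"
    and method_R: "\<And>f. f \<in> L2_space \<Omega> \<Longrightarrow>
           alm_iterates \<Omega> K (TV \<Omega>) \<tau> p0 f (\<lambda>n. R n f) (\<lambda>n. P n f)"
    and "\<rho> > 1"
    and "\<And>k. g_seq k \<in> L2_space \<Omega>"
    and "\<And>k. \<delta> k > 0"
    and "\<And>k. L2_norm \<Omega> (g - g_seq k) \<le> \<delta> k"
    and "\<delta> \<longlonglongrightarrow> 0"
    and "filterlim (\<lambda>k. \<Gamma> (\<delta> k) (g_seq k)) at_top sequentially"
    and "J_minimizing_solution \<Omega> K (TV \<Omega>) g u_dag"
    and "p_dag \<in> L2_space \<Omega>"
    and source: "Kadj p_dag \<in> L2_subdifferential \<Omega> (TV \<Omega>) u_dag"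
  shows "(\<forall>k. d_dist \<Omega> K (TV \<Omega>) (R (\<Gamma> (\<delta> k) (g_seq k)) (g_seq k)) u_dag < \<infinity>) \<and>
         (\<lambda>k. real_of_ereal (d_dist \<Omega> K (TV \<Omega>) (R (\<Gamma> (\<delta> k) (g_seq k)) (g_seq k)) u_dag)) \<in> O(\<delta>)"
proof -
  note \<tau> = assms(9) and \<delta> = assms(16) and \<rho> = assms(14) and gk = assms(15)
  have Kin: "K h \<in> L2_space \<Omega>" if "h \<in> L2_space \<Omega>" for h
    using assms(4) that by (simp add: L2_bounded_linear_def)
  have ud: "u_dag \<in> L2_space \<Omega>" "L2_eq \<Omega> (K u_dag) g"
    using assms(20) by (auto simp: J_minimizing_solution_def)
  have fin_ud: "TV \<Omega> u_dag < \<infinity>" using source by (simp add: L2_subdifferential_def)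
  have noise: "L2_norm \<Omega> (K u_dag - g_seq k) \<le> \<delta> k" for k
  proof -
    have "L2_eq \<Omega> (K u_dag - g_seq k) (g - g_seq k)"
      using ud(2) unfolding L2_eq_def by eventually_elim simp
    then have "L2_norm \<Omega> (K u_dag - g_seq k) = L2_norm \<Omega> (g - g_seq k)"
      by (rule L2_norm_cong) (use Kin[OF ud(1)] gk assms(7) in auto)
    then show ?thesis using assms(17)[of k] by simp
  qed
  define T where "T n = (\<Sum>k=1..n. \<tau> k)" for n
  define D where "D = L2_norm \<Omega> (p0 - p_dag)"
  note bounds = alm_iterates_bounds[OF assms(2-5) \<tau> assms(12) gk method_R[OF gk] ud(1)
      assms(21) source noise, folded T_def D_def]
  have T: "T n \<ge> 0" for n
    unfolding T_def by (intro sum_nonneg less_imp_le[OF \<tau>]) auto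
  have D: "D \<ge> 0" by (simp add: D_def)
  have \<rho>2: "\<rho>\<^sup>2 - 1 > 0" using \<rho> by (simp add: power2_eq_square less_1_mult)
  \<comment> \<open>If the test fails at \<open>n\<close>, the residual bound has
    \<open>(T n * \<delta> k)^2\<close> on the right and \<open>\<rho>^2\<close> times it on the
    left. Since \<open>\<rho> > 1\<close> it can be absorbed, which leaves \<open>A\<close>.\<close>
  define A where "A = D / sqrt (\<rho>\<^sup>2 - 1)"
  have A: "A \<ge> 0" using D \<rho>2 by (simp add: A_def)
  have small: "T n * \<delta> k \<le> A"
    if n: "n \<ge> 1" and res: "\<rho> * \<delta> k \<le> L2_norm \<Omega> (K (R n (g_seq k)) - g_seq k)" for n k
  proof -
    have "(T n)\<^sup>2 * (\<rho> * \<delta> k)\<^sup>2 \<le> (T n)\<^sup>2 * (L2_norm \<Omega> (K (R n (g_seq k)) - g_seq k))\<^sup>2"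
      using res \<delta>[of k] \<rho> by (intro mult_left_mono power_mono) auto
    also have "\<dots> \<le> D\<^sup>2 + (T n * \<delta> k)\<^sup>2" by (rule bounds(2)[OF _ n]) auto
    finally have "(\<rho>\<^sup>2 - 1) * (T n * \<delta> k)\<^sup>2 \<le> D\<^sup>2"
      by (simp add: power_mult_distrib algebra_simps)
    then have "(T n * \<delta> k)\<^sup>2 \<le> A\<^sup>2"
      using \<rho>2 by (simp add: A_def power_divide pos_le_divide_eq mult.commute)
    then show ?thesis using A by (rule power2_le_imp_le)
  qed
  \<comment> \<open>As \<open>T n\<close> diverges, it eventually exceeds
    \<open>A / \<delta> k\<close>; by \<open>small\<close> the test cannot fail there.\<close>
  have stops: "\<exists>n\<ge>1. L2_norm \<Omega> (K (R n (g_seq k)) - g_seq k) < \<rho> * \<delta> k" for k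
  proof -
    have "eventually (\<lambda>n. A / \<delta> k < T n \<and> n \<ge> 1) sequentially"
      using assms(10) eventually_ge_at_top[of "1::nat"]
      unfolding T_def filterlim_at_top_dense by (auto intro: eventually_conj)
    then obtain n where n: "A / \<delta> k < T n" "n \<ge> 1"
      by (auto dest: eventually_happens)
    then have "A < T n * \<delta> k" using \<delta>[of k] by (simp add: pos_divide_less_eq)
    then show ?thesis using small[OF n(2), of k] n(2) by (meson not_le)
  qed
  define N where "N = (\<lambda>k. \<Gamma> (\<delta> k) (g_seq k))"
  have N: "N k \<ge> 1" "L2_norm \<Omega> (K (R (N k) (g_seq k)) - g_seq k) < \<rho> * \<delta> k"
    "\<And>n. 1 \<le> n \<Longrightarrow> n < N k \<Longrightarrow> \<rho> * \<delta> k \<le> L2_norm \<Omega> (K (R n (g_seq k)) - g_seq k)" for k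
    unfolding N_def \<Gamma>_def using morozov_stopping[where R = R, OF stops[of k]] by auto
  obtain B where B: "\<And>n. n \<ge> 1 \<Longrightarrow> \<tau> n \<le> B"
    using assms(11) by (auto simp: bdd_above_def)
  obtain \<Delta> where \<Delta>: "\<And>k. \<delta> k \<le> \<Delta>"
  proof -
    have "Bseq \<delta>" using assms(18) convergent_imp_Bseq convergentI by blast
    then obtain M where "\<And>k. norm (\<delta> k) \<le> M" by (auto simp: Bseq_def)
    then show ?thesis using that[of M] by (auto simp: abs_le_iff)
  qed
  \<comment> \<open>\<open>small\<close> covers indices at which the test fails, so it is applied at
    \<open>N k - 1\<close>; the last step length is bounded by \<open>B\<close>. If
    \<open>N k = 1\<close>, the preceding sum is empty.\<close>
  have TN: "T (N k) * \<delta> k \<le> A + B * \<Delta>" for k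
  proof -
    have split: "T (N k) = T (N k - 1) + \<tau> (N k)"
      using N(1)[of k] unfolding T_def by (cases "N k") auto
    have "T (N k - 1) * \<delta> k \<le> A"
    proof (cases "N k = 1")
      case True then show ?thesis using A by (simp add: T_def)
    next
      case False
      then have "N k - 1 \<ge> 1" "N k - 1 < N k" using N(1)[of k] by auto
      then show ?thesis by (intro small N(3))
    qed
    moreover have "\<tau> (N k) * \<delta> k \<le> B * \<Delta>"
      using B[OF N(1), of k] \<Delta>[of k] \<tau>[OF N(1), of k] \<delta>[of k] by (intro mult_mono) linarith+
    ultimately show ?thesis by (simp add: split algebra_simps)
  qed
  define C where "C = L2_norm \<Omega> p_dag + D + 2 * (A + B * \<Delta>)"
  have dist: "d_dist \<Omega> K (TV \<Omega>) (R (N k) (g_seq k)) u_dag =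
      ereal (L2_norm \<Omega> (K (R (N k) (g_seq k)) - K u_dag)
        + \<bar>real_of_ereal (TV \<Omega> (R (N k) (g_seq k))) - real_of_ereal (TV \<Omega> u_dag)\<bar>)" for k
    using bounds(1)[OF _ N(1)] fin_ud TV_nonneg[of \<Omega> u_dag] TV_nonneg[of \<Omega> "R (N k) (g_seq k)"]
    by (cases "TV \<Omega> u_dag"; cases "TV \<Omega> (R (N k) (g_seq k))") (auto simp: d_dist_def)
  \<comment> \<open>The constant is independent of \<open>k\<close> because \<open>TN\<close> is
    uniform in \<open>k\<close>.\<close>
  have rate: "norm (real_of_ereal (d_dist \<Omega> K (TV \<Omega>) (R (N k) (g_seq k)) u_dag))
      \<le> (1 + C) * (\<rho> + 1) * norm (\<delta> k)" for k
  proof -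
    let ?u = "R (N k) (g_seq k)"
    let ?r = "L2_norm \<Omega> (K ?u - K u_dag)"
    have u: "?u \<in> L2_space \<Omega>"
      using method_R[OF gk[of k]] N(1)[of k] by (simp add: alm_iterates_def)
    have "?r \<le> L2_norm \<Omega> (K ?u - g_seq k) + L2_norm \<Omega> (g_seq k - K u_dag)"
      by (rule L2_norm_triangle_diff) (use Kin u ud gk in auto)
    also have "\<dots> \<le> (\<rho> + 1) * \<delta> k"
      using N(2)[of k] noise[of k] by (simp add: L2_norm_minus_commute[of \<Omega> "g_seq k"] algebra_simps)
    finally have r: "?r \<le> (\<rho> + 1) * \<delta> k" .
    have "\<bar>real_of_ereal (TV \<Omega> ?u) - real_of_ereal (TV \<Omega> u_dag)\<bar>
        \<le> (L2_norm \<Omega> p_dag + D + 2 * T (N k) * \<delta> k) * ?r"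
      by (rule bounds(3)[OF _ N(1)]) auto
    also have "\<dots> \<le> C * ?r"
      using TN[of k] by (intro mult_right_mono) (auto simp: C_def)
    finally have "?r + \<bar>real_of_ereal (TV \<Omega> ?u) - real_of_ereal (TV \<Omega> u_dag)\<bar> \<le> (1 + C) * ?r"
      by (simp add: algebra_simps)
    also have "\<dots> \<le> (1 + C) * ((\<rho> + 1) * \<delta> k)"
    proof (rule mult_left_mono[OF r])
      \<comment> \<open>\<open>B\<close> and \<open>\<Delta>\<close> were chosen only as upper
        bounds; the sign of \<open>A + B * \<Delta>\<close> is read off from
        \<open>TN\<close>.\<close>
      have "0 \<le> T (N k) * \<delta> k" using T[of "N k"] \<delta>[of k] by simp
      then have "0 \<le> A + B * \<Delta>" using TN[of k] by linarith
      then show "0 \<le> 1 + C" using D by (simp add: C_def)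
    qed
    finally show ?thesis using \<delta>[of k] by (simp add: dist mult.assoc)
  qed
  have "(\<lambda>k. real_of_ereal (d_dist \<Omega> K (TV \<Omega>) (R (N k) (g_seq k)) u_dag)) \<in> O(\<delta>)"
    by (rule bigoI) (use rate in \<open>auto intro: always_eventually\<close>)
  moreover have "\<forall>k. d_dist \<Omega> K (TV \<Omega>) (R (N k) (g_seq k)) u_dag < \<infinity>"
    by (simp add: dist)
  ultimately show ?thesis by (simp add: N_def)
qed

end
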